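(* Every symbolic substitution has an ordered Bratteli diagram that is telescope equivalent to the ordered Bratteli diagrams of an infinite number of distinct symbolic substitutions.
   Context: A symbolic substitution on a finite nonempty alphabet $\mathcal L=\{l_1,\dots,l_n\}$ is a map $\sigma:\mathcal L\to\mathcal L^*$ into the finite words over $\mathcal L$. A (labelled) Bratteli diagram $(V,E,r,s,d)$ is an infinite directed graph with $V=\bigsqcup_{n\ge 0}V_n$, $E=\bigsqcup_{n\ge1}E_n$, all $V_n,E_n$ finite and nonempty, with $s(e)\in V_{n-1}$ and $r(e)\in V_n$ for $e\in E_n$; $s^{-1}(v)\ne\varnothing$ for all $v$, $r^{-1}(v)\neq\varnothing$ for all $v\notin V_0$; and a labelling $d:V\to\mathbb N$ with $d(v)=\sum_{r(e)=v}d(s(e))$ for $v\notin V_0$. An ordered Bratteli diagram $(V,E,r,s,d,\le)$ is a Bratteli diagram with a partial order on $E$ such that $e,e'$ are comparable if and only if $r(e)=r(e')$. This extends to finite paths: two paths $(e_k,\dots,e_{k+n})$, $(e_k',\dots,e_{k+n}')$ between the same levels with $r(e_{k+n})=r(e'_{k+n})$ satisfy $(e_k,\dots,e_{k+n})<(e_k',\dots,e_{k+n}')$ iff for some $k\le i\le k+n$ we have $e_i<e_i'$ and $e_j=e_j'$ for all $i<j\le k+n$. Given a strictly increasing sequence $(m_n)_{n\ge0}$ of non-negative integers, the telescoping of an ordered diagram has $V_n'=V_{m_n}$, $E_n'$ the set of paths from $V_{m_{n-1}}$ to $V_{m_n}$, with induced range and source, restricted labelling, and order given by the path order; microscoping is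 the inverse operation. An isomorphism of ordered diagrams is a pair of level-preserving bijections of vertices and edges preserving range, source, labels and order. Two ordered diagrams are telescope equivalent if one is obtained from the other by finitely many telescopings, microscopings and isomorphisms. The ordered Bratteli diagram of a symbolic substitution $\sigma$ has, at every level, one vertex per letter, with all labels $1$ at level $0$; the edges arriving at the vertex of a letter $l$ at level $n\geq 1$ correspond, in increasing order, to the successive letters of the word $\sigma(l)$, the edge corresponding to an occurrence of a letter $l'$ having as source the vertex of $l'$ at level $n-1$ (it is understood that $\sigma(l)$ is nonempty for every letter $l$ and that every letter occurs in some $\sigma(l)$, so that this is a Bratteli diagram). *)

theory Defs
  imports Main "HOL-Library.FuncSet" "HOL-Library.Disjoint_Sets"
begin

section \<open>Symbolic substitutions\<close>

text \<open>
  The alphabet is a finite carrier set. A substitution is extensional, i.e. \<^const>\<open>undefined\<close> off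
  its alphabet, so equality of pairs (alphabet, function) is equality of maps.
\<close>

definition symbolic_substitution :: "'a set \<Rightarrow> ('a \<Rightarrow> 'a list) \<Rightarrow> bool" where
  "symbolic_substitution A \<sigma> \<longleftrightarrow> finite A \<and> A \<noteq> {} \<and> \<sigma> \<in> A \<rightarrow>\<^sub>E lists A"

text \<open>The standing assumptions under which the diagram of a substitution is a Bratteli diagram.\<close>

definition has_diagram :: "'a set \<Rightarrow> ('a \<Rightarrow> 'a list) \<Rightarrow> bool" where
  "has_diagram A \<sigma> \<longleftrightarrow> (\<forall>l\<in>A. \<sigma> l \<noteq> []) \<and> (\<forall>l\<in>A. \<exists>k\<in>A. l \<in> set (\<sigma> k))"

text \<open>
  Being the same up to a renaming of letters. Infinitely many substitutions that are pairwise
  inequivalent in this sense cannot be expected when every \<open>\<sigma> l\<close> is a single letter: \<open>\<sigma>\<close> is then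
  a permutation of \<open>n\<close> letters, and so is every substitution with a telescope equivalent diagram.
\<close>

definition renaming_equivalent ::
  "'a set \<times> ('a \<Rightarrow> 'a list) \<Rightarrow> 'b set \<times> ('b \<Rightarrow> 'b list) \<Rightarrow> bool" where
  "renaming_equivalent = (\<lambda>(A, \<sigma>) (B, \<tau>).
     \<exists>f. bij_betw f A B \<and> (\<forall>l\<in>A. \<tau> (f l) = map f (\<sigma> l)))"


section \<open>Ordered Bratteli diagrams\<close>

text \<open>
  Edge sets are indexed from level 1; \<open>edge D 0\<close> is required to be empty. The functions
  \<open>src\<close>, \<open>rng\<close>, \<open>lab\<close> are only constrained on the edges and vertices of the diagram, whereas
  \<open>le\<close>, the non-strict order, must be a relation on the edges.
\<close>

record ('v, 'e) ordered_diagram =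
  vert :: "nat \<Rightarrow> 'v set"
  edge :: "nat \<Rightarrow> 'e set"
  src  :: "'e \<Rightarrow> 'v"
  rng  :: "'e \<Rightarrow> 'v"
  lab  :: "'v \<Rightarrow> nat"
  le   :: "('e \<times> 'e) set"

abbreviation verts :: "('v, 'e) ordered_diagram \<Rightarrow> 'v set" where
  "verts D \<equiv> (\<Union>n. vert D n)"

abbreviation edges :: "('v, 'e) ordered_diagram \<Rightarrow> 'e set" where
  "edges D \<equiv> (\<Union>n. edge D n)"

text \<open>Labels take values in the positive integers.\<close>

definition bratteli_diagram :: "('v, 'e) ordered_diagram \<Rightarrow> bool" where
  "bratteli_diagram D \<longleftrightarrow>
     (\<forall>n. finite (vert D n) \<and> vert D n \<noteq> {}) \<and>
     disjoint_family (vert D) \<and>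
     edge D 0 = {} \<and>
     (\<forall>n\<ge>1. finite (edge D n) \<and> edge D n \<noteq> {}) \<and>
     disjoint_family (edge D) \<and>
     (\<forall>n\<ge>1. \<forall>e\<in>edge D n. src D e \<in> vert D (n - 1) \<and> rng D e \<in> vert D n) \<and>
     (\<forall>v\<in>verts D. \<exists>e\<in>edges D. src D e = v) \<and>
     (\<forall>v\<in>verts D - vert D 0. \<exists>e\<in>edges D. rng D e = v) \<and>
     (\<forall>v\<in>verts D. 0 < lab D v) \<and>
     (\<forall>v\<in>verts D - vert D 0. lab D v = (\<Sum>e | e \<in> edges D \<and> rng D e = v. lab D (src D e)))"

definition ordered_bratteli_diagram :: "('v, 'e) ordered_diagram \<Rightarrow> bool" where
  "ordered_bratteli_diagram D \<longleftrightarrow>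
     bratteli_diagram D \<and>
     partial_order_on (edges D) (le D) \<and>
     (\<forall>e\<in>edges D. \<forall>e'\<in>edges D. (e, e') \<in> le D \<or> (e', e) \<in> le D \<longleftrightarrow> rng D e = rng D e')"


section \<open>Paths and telescoping\<close>

text \<open>The paths from level \<open>a\<close> to level \<open>b\<close>, listed from the lowest edge to the highest.\<close>

definition paths :: "('v, 'e) ordered_diagram \<Rightarrow> nat \<Rightarrow> nat \<Rightarrow> 'e list set" where
  "paths D a b = {p. length p = b - a \<and>
     (\<forall>i<length p. p ! i \<in> edge D (a + i + 1)) \<and>
     (\<forall>i. Suc i < length p \<longrightarrow> rng D (p ! i) = src D (p ! Suc i))}"

definition path_less :: "('v, 'e) ordered_diagram \<Rightarrow> 'e list \<Rightarrow> 'e list \<Rightarrow> bool" where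
  "path_less D p q \<longleftrightarrow>
     length p = length q \<and> rng D (last p) = rng D (last q) \<and>
     (\<exists>i<length p. (p ! i, q ! i) \<in> le D \<and> p ! i \<noteq> q ! i \<and>
        (\<forall>j. i < j \<and> j < length p \<longrightarrow> p ! j = q ! j))"

definition telescope :: "(nat \<Rightarrow> nat) \<Rightarrow> ('v, 'e) ordered_diagram \<Rightarrow> ('v, 'e list) ordered_diagram" where
  "telescope m D =
     \<lparr> vert = (\<lambda>n. vert D (m n)),
       edge = (\<lambda>n. if n = 0 then {} else paths D (m (n - 1)) (m n)),
       src = (\<lambda>p. src D (hd p)),
       rng = (\<lambda>p. rng D (last p)),
       lab = lab D,
       le = {(p, q). \<exists>n\<ge>1. p \<in> paths D (m (n - 1)) (m n) \<and> q \<in> paths D (m (n - 1)) (m n) \<and>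
               (p = q \<or> path_less D p q)} \<rparr>"


section \<open>Isomorphism and telescope equivalence\<close>

definition diagram_iso :: "('v, 'e) ordered_diagram \<Rightarrow> ('w, 'f) ordered_diagram \<Rightarrow> bool" where
  "diagram_iso D D' \<longleftrightarrow>
     (\<exists>f g. bij_betw f (verts D) (verts D') \<and> (\<forall>n. f ` vert D n = vert D' n) \<and>
            bij_betw g (edges D) (edges D') \<and> (\<forall>n. g ` edge D n = edge D' n) \<and>
            (\<forall>e\<in>edges D. src D' (g e) = f (src D e) \<and> rng D' (g e) = f (rng D e)) \<and>
            (\<forall>v\<in>verts D. lab D' (f v) = lab D v) \<and>
            (\<forall>e\<in>edges D. \<forall>e'\<in>edges D. (g e, g e') \<in> le D' \<longleftrightarrow> (e, e') \<in> le D))"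

text \<open>
  One isomorphism, telescoping or microscoping. As telescoping changes the type of edges, its
  result is taken up to isomorphism.
\<close>

definition elementary_step :: "('v, 'e) ordered_diagram \<Rightarrow> ('w, 'f) ordered_diagram \<Rightarrow> bool" where
  "elementary_step D D' \<longleftrightarrow>
     ordered_bratteli_diagram D \<and> ordered_bratteli_diagram D' \<and>
     (diagram_iso D D' \<or>
      (\<exists>m. strict_mono m \<and> diagram_iso (telescope m D) D') \<or>
      (\<exists>m. strict_mono m \<and> diagram_iso (telescope m D') D))"

text \<open>
  The chain of elementary steps runs through diagrams with vertices and edges in \<^typ>\<open>nat\<close>. This
  is no restriction: a Bratteli diagram is countable, hence isomorphic to one of this type.
\<close>

definition telescope_equivalent ::
  "('v, 'e) ordered_diagram \<Rightarrow> ('w, 'f) ordered_diagram \<Rightarrow> bool" where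
  "telescope_equivalent D D' \<longleftrightarrow>
     ordered_bratteli_diagram D \<and> ordered_bratteli_diagram D' \<and>
     (\<exists>(D\<^sub>0 :: (nat, nat) ordered_diagram) (D\<^sub>1 :: (nat, nat) ordered_diagram).
        diagram_iso D D\<^sub>0 \<and> elementary_step\<^sup>*\<^sup>* D\<^sub>0 D\<^sub>1 \<and> diagram_iso D\<^sub>1 D')"


section \<open>The ordered diagram of a substitution\<close>

text \<open>The labels forced by the label 1 at level 0.\<close>

primrec subst_label :: "('a \<Rightarrow> 'a list) \<Rightarrow> nat \<Rightarrow> 'a \<Rightarrow> nat" where
  "subst_label \<sigma> 0 l = 1"
| "subst_label \<sigma> (Suc n) l = sum_list (map (subst_label \<sigma> n) (\<sigma> l))"

text \<open>
  The vertex of \<open>l\<close> at level \<open>n\<close> is \<open>(n, l)\<close>; the edge \<open>(n, l, i)\<close> arriving there corresponds to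
  the letter at position \<open>i\<close> of \<open>\<sigma> l\<close>.
\<close>

definition subst_diagram ::
  "'a set \<Rightarrow> ('a \<Rightarrow> 'a list) \<Rightarrow> (nat \<times> 'a, nat \<times> 'a \<times> nat) ordered_diagram" where
  "subst_diagram A \<sigma> =
     \<lparr> vert = (\<lambda>n. {n} \<times> A),
       edge = (\<lambda>n. if n = 0 then {} else {(n, l, i) | l i. l \<in> A \<and> i < length (\<sigma> l)}),
       src = (\<lambda>(n, l, i). (n - 1, \<sigma> l ! i)),
       rng = (\<lambda>(n, l, i). (n, l)),
       lab = (\<lambda>(n, l). subst_label \<sigma> n l),
       le = {((n, l, i), (n, l, j)) | n l i j. 1 \<le> n \<and> l \<in> A \<and> i \<le> j \<and> j < length (\<sigma> l)} \<rparr>"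

end

theory Submission
  imports Defs "HOL-Library.Countable_Set"
begin

text \<open>
  Composing \<open>K\<close> consecutive levels of the diagram of a substitution \<open>\<sigma>\<close> amounts to iterating \<open>\<sigma>\<close>.
  The paths through \<open>K\<close> levels that end at the vertex of a letter \<open>l\<close> are linearly ordered, and
  their sources, read in increasing order, spell the word \<open>\<sigma>\<^sup>K l\<close>: the order looks at the last edge
  first, so the paths split into consecutive blocks, one for each letter \<open>x\<close> of \<open>\<sigma> l\<close>, and by
  induction the block of \<open>x\<close> spells \<open>\<sigma>\<^bsup>K - 1\<^esup> x\<close>. Hence telescoping along the multiples of \<open>K\<close> yields
  the diagram of \<open>\<sigma>\<^sup>K\<close> (\<open>diagram_iso_subst_power\<close>), and all positive powers of \<open>\<sigma>\<close> have telescope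
  equivalent diagrams. Renaming letters only changes a diagram by an isomorphism
  (\<open>diagram_iso_renaming\<close>), so each power may be moved to an alphabet of natural numbers.

  It remains to see that infinitely many substitutions arise. If some \<open>\<sigma> l\<close> has at least two
  letters, the total length of the words \<open>\<sigma>\<^sup>k l\<close> grows strictly with \<open>k\<close>
  (\<open>total_length_subst_power_less\<close>); as it is invariant under renaming, no two powers are renamings
  of each other. If all words are single letters, \<open>\<sigma>\<close> is a permutation and its powers may repeat. The
  power \<open>k + 1\<close> is therefore moved to the alphabet \<open>{k..<k + n}\<close>, where \<open>n\<close> is the number of letters,
  and the resulting substitutions are distinct because their alphabets are.

  A telescope equivalence runs through diagrams over the natural numbers. Isomorphic copies of
  this kind exist by countability, and telescoping commutes with passing to them
  (\<open>telescope_equivalentI\<close>).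
\<close>

section \<open>Isomorphisms of ordered diagrams\<close>

lemma diagram_isoI:
  assumes "inj_on f (verts D)" "\<And>n. f ` vert D n = vert D' n"
    and "inj_on g (edges D)" "\<And>n. g ` edge D n = edge D' n"
    and "\<And>e. e \<in> edges D \<Longrightarrow> src D' (g e) = f (src D e)"
    and "\<And>e. e \<in> edges D \<Longrightarrow> rng D' (g e) = f (rng D e)"
    and "\<And>v. v \<in> verts D \<Longrightarrow> lab D' (f v) = lab D v"
    and "\<And>e e'. e \<in> edges D \<Longrightarrow> e' \<in> edges D \<Longrightarrow> (g e, g e') \<in> le D' \<longleftrightarrow> (e, e') \<in> le D"
  shows "diagram_iso D D'"
proof -
  have bij: "bij_betw f (verts D) (verts D')" "bij_betw g (edges D) (edges D')"
    using assms(1-4) by (auto simp: bij_betw_def image_UN)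
  show ?thesis
    unfolding diagram_iso_def
    by (intro exI[of _ f] exI[of _ g] conjI allI ballI; rule bij assms(2,4-8); assumption?)
qed

lemma diagram_isoE:
  assumes "diagram_iso D D'"
  obtains f g where
    "inj_on f (verts D)" "\<And>n. f ` vert D n = vert D' n"
    "inj_on g (edges D)" "\<And>n. g ` edge D n = edge D' n"
    "\<And>e. e \<in> edges D \<Longrightarrow> src D' (g e) = f (src D e)"
    "\<And>e. e \<in> edges D \<Longrightarrow> rng D' (g e) = f (rng D e)"
    "\<And>v. v \<in> verts D \<Longrightarrow> lab D' (f v) = lab D v"
    "\<And>e e'. e \<in> edges D \<Longrightarrow> e' \<in> edges D \<Longrightarrow> (g e, g e') \<in> le D' \<longleftrightarrow> (e, e') \<in> le D"
proof -
  from assms obtain f g where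
    "bij_betw f (verts D) (verts D')" "\<forall>n. f ` vert D n = vert D' n"
    "bij_betw g (edges D) (edges D')" "\<forall>n. g ` edge D n = edge D' n"
    "\<forall>e\<in>edges D. src D' (g e) = f (src D e) \<and> rng D' (g e) = f (rng D e)"
    "\<forall>v\<in>verts D. lab D' (f v) = lab D v"
    "\<forall>e\<in>edges D. \<forall>e'\<in>edges D. (g e, g e') \<in> le D' \<longleftrightarrow> (e, e') \<in> le D"
    unfolding diagram_iso_def by (elim exE conjE) (rule that; assumption)
  then show ?thesis by (intro that[of f g]) (simp_all only: bij_betw_def)
qed

lemma bratteli_edge_ends:
  assumes "bratteli_diagram D" "e \<in> edges D"
  shows "src D e \<in> verts D" "rng D e \<in> verts D"
proof -
  from assms obtain n where n: "e \<in> edge D n" by blast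
  with assms have "n \<ge> 1" by (cases n) (auto simp: bratteli_diagram_def)
  with n assms show "src D e \<in> verts D" "rng D e \<in> verts D"
    unfolding bratteli_diagram_def by blast+
qed

text \<open>
  The inverse of the vertex map gives back the ends of an edge because these are vertices of \<open>D\<close>,
  where the map is injective; this is what the first assumption is for.
\<close>

lemma diagram_iso_sym:
  assumes "bratteli_diagram D" "diagram_iso D D'"
  shows "diagram_iso D' D"
proof -
  from assms(2) obtain f g where
    f: "inj_on f (verts D)" "\<And>n. f ` vert D n = vert D' n" and
    g: "inj_on g (edges D)" "\<And>n. g ` edge D n = edge D' n" and
    s: "\<And>e. e \<in> edges D \<Longrightarrow> src D' (g e) = f (src D e)" and
    r: "\<And>e. e \<in> edges D \<Longrightarrow> rng D' (g e) = f (rng D e)" and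
    lb: "\<And>v. v \<in> verts D \<Longrightarrow> lab D' (f v) = lab D v" and
    l: "\<And>e e'. e \<in> edges D \<Longrightarrow> e' \<in> edges D \<Longrightarrow> (g e, g e') \<in> le D' \<longleftrightarrow> (e, e') \<in> le D"
    by (rule diagram_isoE) (rule that; assumption)
  let ?f = "inv_into (verts D) f" and ?g = "inv_into (edges D) g"
  have V: "verts D' = f ` verts D" and E: "edges D' = g ` edges D"
    by (simp_all only: image_UN f(2) g(2))
  have ff: "?f (f v) = v" if "v \<in> verts D" for v using f(1) that by (rule inv_into_f_f)
  have gg: "?g (g e) = e" if "e \<in> edges D" for e using g(1) that by (rule inv_into_f_f)
  note ends = bratteli_edge_ends[OF assms(1)]
  show ?thesis
  proof (rule diagram_isoI[of ?f _ _ ?g])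
    show "inj_on ?f (verts D')" "inj_on ?g (edges D')"
      by (rule inj_on_inv_into, simp only: V E subset_refl)+
    show "?f ` vert D' n = vert D n" "?g ` edge D' n = edge D n" for n
      unfolding f(2)[symmetric] g(2)[symmetric]
      by (rule inv_into_image_cancel[OF f(1)] inv_into_image_cancel[OF g(1)]; blast)+
    show "src D (?g e) = ?f (src D' e)" "rng D (?g e) = ?f (rng D' e)" if "e \<in> edges D'" for e
    proof -
      from that obtain e0 where "e = g e0" "e0 \<in> edges D" unfolding E by (rule imageE)
      then show "src D (?g e) = ?f (src D' e)" "rng D (?g e) = ?f (rng D' e)"
        by (simp_all only: ff gg s r ends)
    qed
    show "lab D (?f v) = lab D' v" if "v \<in> verts D'" for v
    proof -
      from that obtain u where "v = f u" "u \<in> verts D" unfolding V by (rule imageE)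
      then show ?thesis by (simp only: lb ff)
    qed
    show "(?g e, ?g e') \<in> le D \<longleftrightarrow> (e, e') \<in> le D'" if "e \<in> edges D'" "e' \<in> edges D'" for e e'
    proof -
      from that(1) obtain x where "e = g x" "x \<in> edges D" unfolding E by (rule imageE)
      moreover from that(2) obtain x' where "e' = g x'" "x' \<in> edges D" unfolding E by (rule imageE)
      ultimately show ?thesis by (simp only: gg l)
    qed
  qed
qed

lemma diagram_iso_trans:
  assumes "bratteli_diagram D" "diagram_iso D D'" "diagram_iso D' D''"
  shows "diagram_iso D D''"
proof -
  from assms(2) obtain f g where
    f: "inj_on f (verts D)" "\<And>n. f ` vert D n = vert D' n" and
    g: "inj_on g (edges D)" "\<And>n. g ` edge D n = edge D' n" and
    s: "\<And>e. e \<in> edges D \<Longrightarrow> src D' (g e) = f (src D e)" and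
    r: "\<And>e. e \<in> edges D \<Longrightarrow> rng D' (g e) = f (rng D e)" and
    lb: "\<And>v. v \<in> verts D \<Longrightarrow> lab D' (f v) = lab D v" and
    l: "\<And>e e'. e \<in> edges D \<Longrightarrow> e' \<in> edges D \<Longrightarrow> (g e, g e') \<in> le D' \<longleftrightarrow> (e, e') \<in> le D"
    by (rule diagram_isoE) (rule that; assumption)
  from assms(3) obtain f' g' where
    f': "inj_on f' (verts D')" "\<And>n. f' ` vert D' n = vert D'' n" and
    g': "inj_on g' (edges D')" "\<And>n. g' ` edge D' n = edge D'' n" and
    s': "\<And>e. e \<in> edges D' \<Longrightarrow> src D'' (g' e) = f' (src D' e)" and
    r': "\<And>e. e \<in> edges D' \<Longrightarrow> rng D'' (g' e) = f' (rng D' e)" and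
    lb': "\<And>v. v \<in> verts D' \<Longrightarrow> lab D'' (f' v) = lab D' v" and
    l': "\<And>e e'. e \<in> edges D' \<Longrightarrow> e' \<in> edges D' \<Longrightarrow> (g' e, g' e') \<in> le D'' \<longleftrightarrow> (e, e') \<in> le D'"
    by (rule diagram_isoE) (rule that; assumption)
  have V: "verts D' = f ` verts D" and E: "edges D' = g ` edges D"
    by (simp_all only: image_UN f(2) g(2))
  have Vm: "f v \<in> verts D'" if "v \<in> verts D" for v unfolding V using that by (rule imageI)
  have Em: "g e \<in> edges D'" if "e \<in> edges D" for e unfolding E using that by (rule imageI)
  show ?thesis
  proof (rule diagram_isoI[of "f' \<circ> f" _ _ "g' \<circ> g"])
    show "inj_on (f' \<circ> f) (verts D)" "inj_on (g' \<circ> g) (edges D)"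
      using f(1) f'(1) g(1) g'(1) V E by (simp_all add: comp_inj_on)
    show "(f' \<circ> f) ` vert D n = vert D'' n" "(g' \<circ> g) ` edge D n = edge D'' n" for n
      by (simp_all only: image_comp[symmetric] f f' g g')
  qed (simp_all only: o_apply s r lb l s' r' lb' l' Vm Em)
qed

text \<open>
  An isomorphism says nothing about the order of the target outside its edges, hence the last
  assumption.
\<close>

lemma ordered_bratteli_diagram_iso:
  assumes D: "ordered_bratteli_diagram D" and iso: "diagram_iso D D'"
    and sub: "le D' \<subseteq> edges D' \<times> edges D'"
  shows "ordered_bratteli_diagram D'"
proof -
  from iso obtain f g where
    f: "inj_on f (verts D)" "\<And>n. f ` vert D n = vert D' n" and
    g: "inj_on g (edges D)" "\<And>n. g ` edge D n = edge D' n" and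
    s: "\<And>e. e \<in> edges D \<Longrightarrow> src D' (g e) = f (src D e)" and
    r: "\<And>e. e \<in> edges D \<Longrightarrow> rng D' (g e) = f (rng D e)" and
    lb: "\<And>v. v \<in> verts D \<Longrightarrow> lab D' (f v) = lab D v" and
    l: "\<And>e e'. e \<in> edges D \<Longrightarrow> e' \<in> edges D \<Longrightarrow> (g e, g e') \<in> le D' \<longleftrightarrow> (e, e') \<in> le D"
    by (rule diagram_isoE) (rule that; assumption)
  have bD: "bratteli_diagram D" and po: "partial_order_on (edges D) (le D)"
    and cmp: "\<And>e e'. e \<in> edges D \<Longrightarrow> e' \<in> edges D \<Longrightarrow>
       (e, e') \<in> le D \<or> (e', e) \<in> le D \<longleftrightarrow> rng D e = rng D e'"
    using D unfolding ordered_bratteli_diagram_def by blast+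
  have bdis: "disjoint_family (vert D)" "disjoint_family (edge D)"
    and bends: "\<forall>n\<ge>1. \<forall>e\<in>edge D n. src D e \<in> vert D (n - 1) \<and> rng D e \<in> vert D n"
    and bsrc: "\<forall>v\<in>verts D. \<exists>e\<in>edges D. src D e = v"
    and brng: "\<forall>v\<in>verts D - vert D 0. \<exists>e\<in>edges D. rng D e = v"
    and blab: "\<forall>v\<in>verts D. 0 < lab D v"
    using bD unfolding bratteli_diagram_def by - (elim conjE, assumption)+
  note ends = bratteli_edge_ends[OF bD]
  have V: "verts D' = f ` verts D" and E: "edges D' = g ` edges D"
    by (simp_all only: image_UN f(2) g(2))
  have Em: "g e \<in> edges D'" if "e \<in> edges D" for e unfolding E using that by (rule imageI)
  have EE: thesis if "e \<in> edges D'" "\<And>x. x \<in> edges D \<Longrightarrow> e = g x \<Longrightarrow> thesis" for e thesis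
    using that(1) unfolding E by (rule imageE) (rule that(2))
  have VE: thesis if "v \<in> verts D'" "\<And>u. u \<in> verts D \<Longrightarrow> v = f u \<Longrightarrow> thesis" for v thesis
    using that(1) unfolding V by (rule imageE) (rule that(2))
  have V0: "verts D' - vert D' 0 = f ` (verts D - vert D 0)"
    unfolding V unfolding f(2)[symmetric] by (rule inj_on_image_set_diff[OF f(1), symmetric]) blast+
  have rng_eq: "rng D' (g e) = f v \<longleftrightarrow> rng D e = v" if "e \<in> edges D" "v \<in> verts D" for e v
    unfolding r[OF that(1)] using f(1) ends(2)[OF that(1)] that(2) by (rule inj_on_eq_iff)
  have labsum: "lab D' (f v) = (\<Sum>e | e \<in> edges D' \<and> rng D' e = f v. lab D' (src D' e))"
    if v: "v \<in> verts D - vert D 0" for v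
  proof -
    have v1: "v \<in> verts D" using v by (rule DiffD1)
    let ?I = "{e \<in> edges D. rng D e = v}"
    have I: "{e \<in> edges D'. rng D' e = f v} = g ` ?I"
    proof (intro set_eqI iffI)
      fix y assume y: "y \<in> {e \<in> edges D'. rng D' e = f v}"
      then have "y \<in> edges D'" by (simp only: mem_Collect_eq)
      then obtain e where e: "e \<in> edges D" "y = g e" by (rule EE)
      with y rng_eq[OF e(1) v1] have "e \<in> ?I" by simp
      with e(2) show "y \<in> g ` ?I" by (rule image_eqI)
    next
      fix y assume "y \<in> g ` ?I"
      then obtain e where e: "e \<in> edges D" "rng D e = v" "y = g e" by auto
      with rng_eq[OF e(1) v1] Em[OF e(1)] show "y \<in> {e \<in> edges D'. rng D' e = f v}" by simp
    qed
    have inj: "inj_on g ?I" using g(1) by (rule inj_on_subset) (rule Collect_subset)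
    have "lab D' (f v) = lab D v" using v1 by (rule lb)
    also have "\<dots> = (\<Sum>e\<in>?I. lab D (src D e))"
      using bD v unfolding bratteli_diagram_def by (elim conjE) (rule bspec)
    also have "\<dots> = (\<Sum>e\<in>?I. lab D' (src D' (g e)))"
      by (rule sum.cong) (simp_all only: mem_Collect_eq s lb ends)
    also have "\<dots> = (\<Sum>e | e \<in> edges D' \<and> rng D' e = f v. lab D' (src D' e))"
      unfolding I sum.reindex[OF inj] by (simp only: o_def)
    finally show ?thesis .
  qed
  have bD': "bratteli_diagram D'"
    unfolding bratteli_diagram_def
  proof (intro conjI)
    show "\<forall>n. finite (vert D' n) \<and> vert D' n \<noteq> {}" "edge D' 0 = {}"
      "\<forall>n\<ge>1. finite (edge D' n) \<and> edge D' n \<noteq> {}"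
      using bD unfolding bratteli_diagram_def f(2)[symmetric] g(2)[symmetric] by simp_all
    have "vert D' i \<inter> vert D' j = {}" "edge D' i \<inter> edge D' j = {}" if "i \<noteq> j" for i j
    proof -
      have "vert D i \<inter> vert D j = {}" "edge D i \<inter> edge D j = {}"
        using bdis that by (simp_all add: disjoint_family_on_def)
      moreover have "f ` (vert D i \<inter> vert D j) = f ` vert D i \<inter> f ` vert D j"
        using f(1) by (rule inj_on_image_Int) blast+
      moreover have "g ` (edge D i \<inter> edge D j) = g ` edge D i \<inter> g ` edge D j"
        using g(1) by (rule inj_on_image_Int) blast+
      ultimately show "vert D' i \<inter> vert D' j = {}" "edge D' i \<inter> edge D' j = {}"
        by (simp_all only: f(2) g(2) image_empty)
    qed
    then show "disjoint_family (vert D')" "disjoint_family (edge D')"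
      unfolding disjoint_family_on_def by simp_all
    show "\<forall>n\<ge>1. \<forall>e\<in>edge D' n. src D' e \<in> vert D' (n - 1) \<and> rng D' e \<in> vert D' n"
    proof (intro allI impI ballI)
      fix n :: nat and e assume n: "1 \<le> n" and "e \<in> edge D' n"
      then obtain x where x: "x \<in> edge D n" "e = g x" using g(2) by blast
      then have "src D x \<in> vert D (n - 1)" "rng D x \<in> vert D n"
        using bends n by blast+
      moreover have "x \<in> edges D" using x by blast
      ultimately show "src D' e \<in> vert D' (n - 1) \<and> rng D' e \<in> vert D' n"
        unfolding f(2)[symmetric] using x(2) s r by simp
    qed
    show "\<forall>v\<in>verts D'. \<exists>e\<in>edges D'. src D' e = v"
    proof
      fix v assume "v \<in> verts D'"
      then obtain u where u: "u \<in> verts D" "v = f u" by (rule VE)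
      from bsrc u(1) have "\<exists>e\<in>edges D. src D e = u" by (rule bspec)
      then obtain e where e: "e \<in> edges D" "src D e = u" by (rule bexE)
      show "\<exists>e\<in>edges D'. src D' e = v"
        using Em[OF e(1)] by (rule bexI[rotated]) (simp only: s e u)
    qed
    show "\<forall>v\<in>verts D' - vert D' 0. \<exists>e\<in>edges D'. rng D' e = v"
    proof
      fix v assume "v \<in> verts D' - vert D' 0"
      then obtain u where u: "u \<in> verts D - vert D 0" "v = f u" unfolding V0 by (rule imageE)
      from brng u(1) have "\<exists>e\<in>edges D. rng D e = u" by (rule bspec)
      then obtain e where e: "e \<in> edges D" "rng D e = u" by (rule bexE)
      show "\<exists>e\<in>edges D'. rng D' e = v"
        using Em[OF e(1)] by (rule bexI[rotated]) (simp only: r e u)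
    qed
    show "\<forall>v\<in>verts D'. 0 < lab D' v"
    proof
      fix v assume "v \<in> verts D'"
      then obtain u where u: "u \<in> verts D" "v = f u" by (rule VE)
      from blab u(1) have "0 < lab D u" by (rule bspec)
      then show "0 < lab D' v" by (simp only: u lb)
    qed
    show "\<forall>v\<in>verts D' - vert D' 0.
        lab D' v = (\<Sum>e | e \<in> edges D' \<and> rng D' e = v. lab D' (src D' e))"
      unfolding V0 by (intro ballI, elim imageE) (simp only: labsum)
  qed
  have po': "partial_order_on (edges D') (le D')"
  proof -
    have re: "refl_on (edges D) (le D)" and tr: "trans (le D)" and an: "antisym (le D)"
      using po by (simp_all add: partial_order_on_def preorder_on_def)
    have "refl_on (edges D') (le D')"
    proof (rule refl_onI)
      fix x assume "x \<in> edges D'"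
      then obtain a where "a \<in> edges D" "x = g a" by (rule EE)
      then show "(x, x) \<in> le D'" using l[of a a] refl_onD[OF re] by simp
    qed
    moreover have "trans (le D')"
    proof (rule transI)
      fix x y z assume xy: "(x, y) \<in> le D'" and yz: "(y, z) \<in> le D'"
      then have "x \<in> edges D'" "y \<in> edges D'" "z \<in> edges D'" using sub by blast+
      then obtain a b c where abc: "x = g a" "y = g b" "z = g c"
        "a \<in> edges D" "b \<in> edges D" "c \<in> edges D"
        by (elim EE) (rule that)
      then have "(a, c) \<in> le D" using xy yz l transD[OF tr, of a b c] by simp
      then show "(x, z) \<in> le D'" using abc l by simp
    qed
    moreover have "antisym (le D')"
    proof (rule antisymI)
      fix x y assume xy: "(x, y) \<in> le D'" "(y, x) \<in> le D'"
      then have "x \<in> edges D'" "y \<in> edges D'" using sub by blast+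
      then obtain a b where "x = g a" "y = g b" "a \<in> edges D" "b \<in> edges D"
        by (elim EE) (rule that)
      then show "x = y" using xy l antisymD[OF an, of a b] by simp
    qed
    ultimately show ?thesis using sub by (simp add: partial_order_on_def preorder_on_def)
  qed
  have cmp': "(e, e') \<in> le D' \<or> (e', e) \<in> le D' \<longleftrightarrow> rng D' e = rng D' e'"
    if e: "e \<in> edges D'" "e' \<in> edges D'" for e e'
  proof -
    from e obtain x x' where x: "x \<in> edges D" "e = g x" "x' \<in> edges D" "e' = g x'"
      by (elim EE) (rule that)
    have "rng D' e = rng D' e' \<longleftrightarrow> rng D x = rng D x'"
      using rng_eq[OF x(1) ends(2)[OF x(3)]] r[OF x(3)] x by simp
    then show ?thesis using l[of x x'] l[of x' x] cmp[of x x'] x by simp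
  qed
  show ?thesis unfolding ordered_bratteli_diagram_def
    by (intro conjI ballI bD' po' cmp')
qed

text \<open>Transport of structure along injections into \<^typ>\<open>nat\<close>, which exist by countability.\<close>

lemma ordered_bratteli_diagram_nat_copy:
  assumes "ordered_bratteli_diagram D"
  obtains D0 :: "(nat, nat) ordered_diagram"
  where "ordered_bratteli_diagram D0" "diagram_iso D D0"
proof -
  have bD: "bratteli_diagram D"
    using assms by (simp add: ordered_bratteli_diagram_def)
  have "finite (vert D n)" "finite (edge D n)" for n
    using bD by (cases n; simp add: bratteli_diagram_def)+
  then have "countable (verts D)" "countable (edges D)"
    by (simp_all add: countable_finite)
  then obtain f g :: "_ \<Rightarrow> nat" where f: "inj_on f (verts D)" and g: "inj_on g (edges D)"
    by (meson countableE)
  define h where "h = inv_into (edges D) g"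
  have h: "h (g e) = e" if "e \<in> edges D" for e
    unfolding h_def using g that by (rule inv_into_f_f)
  let ?D0 = "\<lparr> vert = (\<lambda>n. f ` vert D n), edge = (\<lambda>n. g ` edge D n),
     src = (\<lambda>e. f (src D (h e))), rng = (\<lambda>e. f (rng D (h e))),
     lab = (\<lambda>v. lab D (inv_into (verts D) f v)),
     le = map_prod g g ` (le D \<inter> edges D \<times> edges D) \<rparr>"
  have iso: "diagram_iso D ?D0"
  proof (rule diagram_isoI[OF f _ g])
    show "lab ?D0 (f v) = lab D v" if "v \<in> verts D" for v
      using inv_into_f_f[OF f that] by simp
    show "(g e, g e') \<in> le ?D0 \<longleftrightarrow> (e, e') \<in> le D"
      if "e \<in> edges D" "e' \<in> edges D" for e e'
    proof
      assume "(g e, g e') \<in> le ?D0"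
      then obtain x y where xy: "(x, y) \<in> le D" "x \<in> edges D" "y \<in> edges D" "g e = g x" "g e' = g y"
        by auto
      then have "e = x" "e' = y" using that g by (auto dest: inj_onD)
      with xy show "(e, e') \<in> le D" by simp
    next
      assume "(e, e') \<in> le D"
      with that show "(g e, g e') \<in> le ?D0" by force
    qed
  qed (simp_all add: h del: UN_iff)
  moreover have "le ?D0 \<subseteq> edges ?D0 \<times> edges ?D0" by auto
  ultimately show ?thesis
    using that[of ?D0] ordered_bratteli_diagram_iso[OF assms iso] by blast
qed


section \<open>Telescoping respects isomorphism\<close>

lemma paths_nthD:
  assumes "p \<in> paths D a b" "i < length p"
  shows "p ! i \<in> edges D"
  using assms unfolding paths_def by blast

lemma last_path:
  assumes "p \<in> paths D a b" "a < b"
  shows "last p \<in> edge D b"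
proof -
  have len: "length p = b - a" and mem: "\<forall>i<length p. p ! i \<in> edge D (a + i + 1)"
    using assms(1) by (simp_all add: paths_def)
  have "p ! (length p - 1) \<in> edge D (a + (length p - 1) + 1)"
    using len assms(2) by (intro mem[rule_format]) simp
  moreover have "p \<noteq> []" using len assms(2) by auto
  ultimately show ?thesis using len assms(2) by (simp add: last_conv_nth)
qed

lemma telescope_edgesE:
  assumes "p \<in> edges (telescope m D)"
  obtains n where "1 \<le> n" "p \<in> paths D (m (n - 1)) (m n)"
proof -
  from assms obtain n where n: "p \<in> edge (telescope m D) n" by blast
  then have "1 \<le> n" "p \<in> paths D (m (n - 1)) (m n)"
    by (simp_all add: telescope_def split: if_splits)
  then show ?thesis by (rule that)
qed

lemma telescope_le_iff:
  assumes "p \<in> edge (telescope m D) n" "q \<in> edge (telescope m D) n"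
  shows "(p, q) \<in> le (telescope m D) \<longleftrightarrow> p = q \<or> path_less D p q"
proof -
  have "1 \<le> n" "p \<in> paths D (m (n - 1)) (m n)" "q \<in> paths D (m (n - 1)) (m n)"
    using assms by (simp_all add: telescope_def split: if_splits)
  then show ?thesis unfolding telescope_def ordered_diagram.simps by blast
qed

text \<open>
  Both comparisons would be decided at the highest position where the paths differ, and there the
  edge order is antisymmetric.
\<close>

lemma path_less_asym:
  assumes "antisym (le D)" "path_less D p q"
  shows "\<not> path_less D q p"
proof
  assume "path_less D q p"
  then obtain i where i: "i < length q" "(q ! i, p ! i) \<in> le D" "p ! i \<noteq> q ! i"
    "\<forall>j. i < j \<and> j < length q \<longrightarrow> q ! j = p ! j"
    unfolding path_less_def by metis
  from assms(2) obtain j where j: "j < length p" "(p ! j, q ! j) \<in> le D" "p ! j \<noteq> q ! j"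
    "\<forall>i. j < i \<and> i < length p \<longrightarrow> p ! i = q ! i" and len: "length p = length q"
    unfolding path_less_def by metis
  have "i = j" using i j len by (metis nat_neq_iff)
  with i j show False using antisymD[OF assms(1)] by metis
qed

lemma path_less_irrefl: "\<not> path_less D p p"
  by (simp add: path_less_def)

text \<open>
  An isomorphism acts on paths edge by edge. That composability and the order are also reflected
  uses its injectivity, and strict monotonicity of \<open>m\<close> keeps the paths nonempty, so that they have
  a source and a range.
\<close>

lemma diagram_iso_telescope:
  assumes bD: "bratteli_diagram D" and iso: "diagram_iso D D'" and m: "strict_mono m"
  shows "diagram_iso (telescope m D) (telescope m D')"
proof -
  from iso obtain f g where
    f: "inj_on f (verts D)" "\<And>n. f ` vert D n = vert D' n" and
    g: "inj_on g (edges D)" "\<And>n. g ` edge D n = edge D' n" and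
    s: "\<And>e. e \<in> edges D \<Longrightarrow> src D' (g e) = f (src D e)" and
    r: "\<And>e. e \<in> edges D \<Longrightarrow> rng D' (g e) = f (rng D e)" and
    lb: "\<And>v. v \<in> verts D \<Longrightarrow> lab D' (f v) = lab D v" and
    l: "\<And>e e'. e \<in> edges D \<Longrightarrow> e' \<in> edges D \<Longrightarrow> (g e, g e') \<in> le D' \<longleftrightarrow> (e, e') \<in> le D"
    by (rule diagram_isoE) (rule that; assumption)
  note ends = bratteli_edge_ends[OF bD]
  have feq: "f u = f v \<longleftrightarrow> u = v" if "u \<in> verts D" "v \<in> verts D" for u v
    using f(1) that by (auto dest: inj_onD)
  have geq: "g u = g v \<longleftrightarrow> u = v" if "u \<in> edges D" "v \<in> edges D" for u v
    using g(1) that by (auto dest: inj_onD)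
  have mono: "m (n - 1) < m n" if "1 \<le> n" for n
    using m that by (simp add: strict_mono_def)
  have mem: "g e \<in> edge D' n \<longleftrightarrow> e \<in> edge D n" if "e \<in> edges D" for e n
    unfolding g(2)[symmetric] using that geq by blast
  have map_paths: "map g p \<in> paths D' a b \<longleftrightarrow> p \<in> paths D a b"
    if p: "set p \<subseteq> edges D" for p a b
  proof -
    have pi: "p ! i \<in> edges D" if "i < length p" for i using p nth_mem[OF that] by blast
    have "(g (p ! i) \<in> edge D' (a + i + 1)) = (p ! i \<in> edge D (a + i + 1))"
      if "i < length p" for i using mem pi that by blast
    moreover have "(rng D' (g (p ! i)) = src D' (g (p ! Suc i))) = (rng D (p ! i) = src D (p ! Suc i))"
      if "Suc i < length p" for i
      unfolding r[OF pi[OF Suc_lessD[OF that]]] s[OF pi[OF that]]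
      by (intro feq ends pi that Suc_lessD[OF that])
    ultimately show ?thesis unfolding paths_def by auto
  qed
  have psub: "set p \<subseteq> edges D" if "p \<in> paths D a b" for p a b
    using that paths_nthD by (metis in_set_conv_nth subsetI)
  have image_paths: "map g ` paths D a b = paths D' a b" for a b
  proof
    show "map g ` paths D a b \<subseteq> paths D' a b" using map_paths psub by blast
    show "paths D' a b \<subseteq> map g ` paths D a b"
    proof
      fix q assume q: "q \<in> paths D' a b"
      then have "set q \<subseteq> edges D'" using paths_nthD by (metis in_set_conv_nth subsetI)
      also have "edges D' = g ` edges D" by (simp only: image_UN g(2))
      finally have "q \<in> map g ` lists (edges D)"
        unfolding lists_image[symmetric] by (simp only: lists_eq_set mem_Collect_eq)
      then obtain p where p: "p \<in> lists (edges D)" "q = map g p" by blast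
      then have "p \<in> paths D a b"
        using q map_paths[of p a b] by (simp only: lists_eq_set mem_Collect_eq)
      with p(2) show "q \<in> map g ` paths D a b" by (rule image_eqI)
    qed
  qed
  have ne: "p \<noteq> []" "hd p \<in> edges D" "last p \<in> edges D" "set p \<subseteq> edges D"
    if "p \<in> edges (telescope m D)" for p
  proof -
    from that obtain n where n: "1 \<le> n" "p \<in> paths D (m (n - 1)) (m n)"
      by (rule telescope_edgesE)
    then have "length p > 0" using mono by (simp add: paths_def)
    then show "p \<noteq> []" by simp
    show "set p \<subseteq> edges D" using n psub by blast
    with \<open>p \<noteq> []\<close> show "hd p \<in> edges D" "last p \<in> edges D" by (meson hd_in_set last_in_set subsetD)+
  qed
  have less: "path_less D' (map g p) (map g q) \<longleftrightarrow> path_less D p q"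
    if "p \<in> edges (telescope m D)" "q \<in> edges (telescope m D)" for p q
  proof (cases "length p = length q")
    case True
    note np = ne[OF that(1)] and nq = ne[OF that(2)]
    have "p ! i \<in> edges D" "q ! i \<in> edges D" if "i < length p" for i
      using np(4) nq(4) that True by (metis nth_mem subsetD)+
    then have "(g (p ! i), g (q ! i)) \<in> le D' \<longleftrightarrow> (p ! i, q ! i) \<in> le D"
      "g (p ! i) = g (q ! i) \<longleftrightarrow> p ! i = q ! i" if "i < length p" for i
      using that by (simp_all only: l geq)
    moreover have "rng D' (g (last p)) = rng D' (g (last q)) \<longleftrightarrow> rng D (last p) = rng D (last q)"
      unfolding r[OF np(3)] r[OF nq(3)] by (intro feq ends np(3) nq(3))
    ultimately show ?thesis
      unfolding path_less_def using True np(1) nq(1) by (auto simp: last_map)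
  qed (simp add: path_less_def)
  show ?thesis
  proof (rule diagram_isoI[of f _ _ "map g"])
    show "inj_on f (verts (telescope m D))"
      by (rule inj_on_subset[OF f(1)]) (auto simp: telescope_def)
    show "f ` vert (telescope m D) n = vert (telescope m D') n" for n
      by (simp add: telescope_def f(2))
    show inj: "inj_on (map g) (edges (telescope m D))"
    proof (rule inj_onI)
      fix p q assume pq: "p \<in> edges (telescope m D)" "q \<in> edges (telescope m D)" "map g p = map g q"
      have "inj_on g (set p \<union> set q)"
        using ne(4)[OF pq(1)] ne(4)[OF pq(2)] by (intro inj_on_subset[OF g(1)]) blast
      with pq(3) show "p = q" by (simp add: inj_on_map_eq_map)
    qed
    show "map g ` edge (telescope m D) n = edge (telescope m D') n" for n
      by (simp add: telescope_def image_paths)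
    fix p assume p: "p \<in> edges (telescope m D)"
    show "src (telescope m D') (map g p) = f (src (telescope m D) p)"
      "rng (telescope m D') (map g p) = f (rng (telescope m D) p)"
      using ne[OF p] s r by (simp_all add: telescope_def hd_map last_map)
    fix q assume q: "q \<in> edges (telescope m D)"
    have "map g p = map g q \<longleftrightarrow> p = q" using inj p q by (auto dest: inj_onD)
    moreover have "map g p \<in> paths D' a b \<longleftrightarrow> p \<in> paths D a b"
      "map g q \<in> paths D' a b \<longleftrightarrow> q \<in> paths D a b" for a b
      by (rule map_paths[OF ne(4)[OF p]] map_paths[OF ne(4)[OF q]])+
    ultimately show "(map g p, map g q) \<in> le (telescope m D') \<longleftrightarrow> (p, q) \<in> le (telescope m D)"
      using less[OF p q] by (simp add: telescope_def)
  next
    fix v assume "v \<in> verts (telescope m D)"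
    then have "v \<in> verts D" by (auto simp: telescope_def)
    then show "lab (telescope m D') (f v) = lab (telescope m D) v"
      using lb by (simp add: telescope_def)
  qed
qed

text \<open>
  One telescoping between copies over \<^typ>\<open>nat\<close> suffices as a chain of elementary steps.
\<close>

lemma telescope_equivalentI:
  assumes D: "ordered_bratteli_diagram D" and D': "ordered_bratteli_diagram D'"
    and m: "strict_mono m" and iso: "diagram_iso D' (telescope m D)"
  shows "telescope_equivalent D D'"
proof -
  obtain D0 :: "(nat, nat) ordered_diagram"
    where D0: "ordered_bratteli_diagram D0" "diagram_iso D D0"
    using D by (rule ordered_bratteli_diagram_nat_copy)
  obtain D1 :: "(nat, nat) ordered_diagram"
    where D1: "ordered_bratteli_diagram D1" "diagram_iso D' D1"
    using D' by (rule ordered_bratteli_diagram_nat_copy)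
  have b: "bratteli_diagram D" "bratteli_diagram D'" "bratteli_diagram D1"
    using D D' D1(1) by (simp_all add: ordered_bratteli_diagram_def)
  note D1D' = diagram_iso_sym[OF b(2) D1(2)]
  have "diagram_iso D1 (telescope m D0)"
    using diagram_iso_trans[OF b(3) D1D' diagram_iso_trans[OF b(2) iso diagram_iso_telescope[OF b(1) D0(2) m]]] .
  then have "diagram_iso (telescope m D0) D1"
    by (rule diagram_iso_sym[OF b(3)])
  then have "elementary_step D0 D1"
    unfolding elementary_step_def using D0(1) D1(1) m by blast
  then show ?thesis
    unfolding telescope_equivalent_def using D D' D0(2) D1D' by blast
qed



section \<open>The diagram of a substitution\<close>

lemma subst_diagram_simps [simp]:
  "vert (subst_diagram A \<sigma>) n = {n} \<times> A"
  "src (subst_diagram A \<sigma>) (n, l, i) = (n - 1, \<sigma> l ! i)"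
  "rng (subst_diagram A \<sigma>) (n, l, i) = (n, l)"
  "lab (subst_diagram A \<sigma>) (n, l) = subst_label \<sigma> n l"
  by (simp_all add: subst_diagram_def)

lemma verts_subst_diagram: "verts (subst_diagram A \<sigma>) = (UNIV :: nat set) \<times> A"
  by auto

lemma edge_subst_diagram:
  "edge (subst_diagram A \<sigma>) n = {(k, l, i). k = n \<and> 1 \<le> n \<and> l \<in> A \<and> i < length (\<sigma> l)}"
  by (auto simp: subst_diagram_def)

lemma edges_subst_diagram:
  "edges (subst_diagram A \<sigma>) = {(n, l, i). 1 \<le> n \<and> l \<in> A \<and> i < length (\<sigma> l)}"
  unfolding edge_subst_diagram by auto

lemma le_subst_diagram:
  "((n, l, i), (n', l', j)) \<in> le (subst_diagram A \<sigma>) \<longleftrightarrow>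
     n' = n \<and> l' = l \<and> 1 \<le> n \<and> l \<in> A \<and> i \<le> j \<and> j < length (\<sigma> l)"
  by (auto simp: subst_diagram_def)

lemma antisym_le_subst_diagram: "antisym (le (subst_diagram A \<sigma>))"
  by (auto simp: antisym_def subst_diagram_def)

lemma subst_label_pos:
  assumes "\<sigma> \<in> A \<rightarrow> lists A" "has_diagram A \<sigma>" "l \<in> A"
  shows "0 < subst_label \<sigma> n l"
  using assms(3)
proof (induction n arbitrary: l)
  case (Suc n)
  then obtain x xs where x: "\<sigma> l = x # xs"
    using assms(2) by (auto simp: has_diagram_def neq_Nil_conv)
  then have "x \<in> A" using assms(1) Suc.prems by (auto dest: funcset_mem)
  with Suc.IH x show ?case by simp
qed simp

lemma ordered_bratteli_subst_diagram:
  assumes fin: "finite A" and ne: "A \<noteq> {}" and \<sigma>: "\<sigma> \<in> A \<rightarrow> lists A" and d: "has_diagram A \<sigma>"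
  shows "ordered_bratteli_diagram (subst_diagram A \<sigma>)" (is "ordered_bratteli_diagram ?D")
proof -
  have nonempty: "\<sigma> l \<noteq> []" if "l \<in> A" for l using d that by (auto simp: has_diagram_def)
  have letter: "\<sigma> l ! i \<in> A" if "l \<in> A" "i < length (\<sigma> l)" for l i
    using \<sigma> that by (auto dest!: funcset_mem)
  have "bratteli_diagram ?D"
    unfolding bratteli_diagram_def verts_subst_diagram edges_subst_diagram
  proof (intro conjI)
    show "\<forall>n. finite (vert ?D n) \<and> vert ?D n \<noteq> {}" using fin ne by simp
    show "disjoint_family (vert ?D)" "disjoint_family (edge ?D)" "edge ?D 0 = {}"
      by (auto simp: disjoint_family_on_def edge_subst_diagram)
    show "\<forall>n\<ge>1. finite (edge ?D n) \<and> edge ?D n \<noteq> {}"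
    proof (intro allI impI conjI)
      fix n :: nat assume n: "1 \<le> n"
      have "edge ?D n \<subseteq> (\<lambda>(l, i). (n, l, i)) ` (SIGMA l:A. {..<length (\<sigma> l)})"
        by (auto simp: edge_subst_diagram)
      then show "finite (edge ?D n)" using fin by (auto intro: finite_subset)
      from ne obtain l where "l \<in> A" by blast
      then have "(n, l, 0) \<in> edge ?D n" using n nonempty by (auto simp: edge_subst_diagram)
      then show "edge ?D n \<noteq> {}" by blast
    qed
    show "\<forall>n\<ge>1. \<forall>e\<in>edge ?D n. src ?D e \<in> vert ?D (n - 1) \<and> rng ?D e \<in> vert ?D n"
      using letter by (auto simp: edge_subst_diagram)
    show "\<forall>v\<in>(UNIV :: nat set) \<times> A. \<exists>e\<in>{(n, l, i). 1 \<le> n \<and> l \<in> A \<and> i < length (\<sigma> l)}. src ?D e = v"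
    proof
      fix v assume "v \<in> (UNIV :: nat set) \<times> A"
      then obtain n l where v: "v = (n, l)" "l \<in> A" by auto
      then obtain k i where "k \<in> A" "i < length (\<sigma> k)" "\<sigma> k ! i = l"
        using d unfolding has_diagram_def by (metis in_set_conv_nth)
      then show "\<exists>e\<in>{(n, l, i). 1 \<le> n \<and> l \<in> A \<and> i < length (\<sigma> l)}. src ?D e = v"
        using v by (intro bexI[of _ "(Suc n, k, i)"]) auto
    qed
    show "\<forall>v\<in>(UNIV :: nat set) \<times> A - vert ?D 0.
        \<exists>e\<in>{(n, l, i). 1 \<le> n \<and> l \<in> A \<and> i < length (\<sigma> l)}. rng ?D e = v"
    proof
      fix v assume "v \<in> (UNIV :: nat set) \<times> A - vert ?D 0"
      then obtain n l where v: "v = (n, l)" "l \<in> A" "1 \<le> n" by (auto simp: Suc_le_eq)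
      then show "\<exists>e\<in>{(n, l, i). 1 \<le> n \<and> l \<in> A \<and> i < length (\<sigma> l)}. rng ?D e = v"
        using nonempty by (intro bexI[of _ "(n, l, 0)"]) auto
    qed
    show "\<forall>v\<in>(UNIV :: nat set) \<times> A. 0 < lab ?D v"
      using subst_label_pos[OF \<sigma> d] by auto
    show "\<forall>v\<in>(UNIV :: nat set) \<times> A - vert ?D 0. lab ?D v =
        (\<Sum>e | e \<in> {(n, l, i). 1 \<le> n \<and> l \<in> A \<and> i < length (\<sigma> l)} \<and> rng ?D e = v. lab ?D (src ?D e))"
    proof
      fix v assume "v \<in> (UNIV :: nat set) \<times> A - vert ?D 0"
      then obtain k l where "v = (k, l)" "k \<noteq> 0" "l \<in> A" by auto
      then obtain n where v: "v = (Suc n, l)" "l \<in> A" by (cases k) simp_all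
      have "{e. e \<in> {(n, l, i). 1 \<le> n \<and> l \<in> A \<and> i < length (\<sigma> l)} \<and> rng ?D e = v}
          = (\<lambda>i. (Suc n, l, i)) ` {..<length (\<sigma> l)}"
        using v by auto
      moreover have "inj_on (\<lambda>i. (Suc n, l, i)) {..<length (\<sigma> l)}"
        by (auto intro: inj_onI)
      ultimately show "lab ?D v =
        (\<Sum>e | e \<in> {(n, l, i). 1 \<le> n \<and> l \<in> A \<and> i < length (\<sigma> l)} \<and> rng ?D e = v. lab ?D (src ?D e))"
        using v by (simp add: sum.reindex sum_list_sum_nth atLeast0LessThan)
    qed
  qed
  moreover have "partial_order_on (edges ?D) (le ?D)"
    unfolding partial_order_on_def preorder_on_def edges_subst_diagram
  proof (intro conjI antisym_le_subst_diagram)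
    show "le ?D \<subseteq> {(n, l, i). 1 \<le> n \<and> l \<in> A \<and> i < length (\<sigma> l)} \<times>
        {(n, l, i). 1 \<le> n \<and> l \<in> A \<and> i < length (\<sigma> l)}"
      by (auto simp: le_subst_diagram)
    show "refl_on {(n, l, i). 1 \<le> n \<and> l \<in> A \<and> i < length (\<sigma> l)} (le ?D)"
      by (auto simp: refl_on_def le_subst_diagram)
    show "trans (le ?D)" by (auto simp: trans_def le_subst_diagram)
  qed
  moreover have "\<forall>e\<in>edges ?D. \<forall>e'\<in>edges ?D. (e, e') \<in> le ?D \<or> (e', e) \<in> le ?D \<longleftrightarrow> rng ?D e = rng ?D e'"
    unfolding edges_subst_diagram by (auto simp: le_subst_diagram)
  ultimately show ?thesis unfolding ordered_bratteli_diagram_def by (intro conjI)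
qed

lemma diagram_iso_renaming:
  assumes \<sigma>: "\<sigma> \<in> A \<rightarrow> lists A" and ren: "renaming_equivalent (A, \<sigma>) (B, \<tau>)"
  shows "diagram_iso (subst_diagram A \<sigma>) (subst_diagram B \<tau>)"
proof -
  from ren obtain h where h: "inj_on h A" "B = h ` A"
    and \<tau>: "\<And>l. l \<in> A \<Longrightarrow> \<tau> (h l) = map h (\<sigma> l)"
    unfolding renaming_equivalent_def by (auto simp: bij_betw_def)
  have heq: "h l = h l' \<longleftrightarrow> l = l'" if "l \<in> A" "l' \<in> A" for l l'
    using h(1) that by (auto dest: inj_onD)
  have label: "subst_label \<tau> n (h l) = subst_label \<sigma> n l" if "l \<in> A" for n l
    using that
  proof (induction n arbitrary: l)
    case (Suc n)
    have "set (\<sigma> l) \<subseteq> A" using \<sigma> Suc.prems by (auto dest: funcset_mem)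
    then have "map (\<lambda>x. subst_label \<tau> n (h x)) (\<sigma> l) = map (subst_label \<sigma> n) (\<sigma> l)"
      using Suc.IH by (auto intro: map_cong)
    then show ?case using \<tau>[OF Suc.prems] by (simp add: o_def cong: map_cong)
  qed simp
  show ?thesis
  proof (rule diagram_isoI[of "map_prod id h" _ _ "\<lambda>(n, l, i). (n, h l, i)"];
      (unfold verts_subst_diagram edges_subst_diagram)?)
    show "inj_on (map_prod id h) ((UNIV :: nat set) \<times> A)"
      using h(1) by (auto simp: inj_on_def)
    show "inj_on (\<lambda>(n, l, i). (n, h l, i)) {(n, l, i). 1 \<le> n \<and> l \<in> A \<and> i < length (\<sigma> l)}"
      using h(1) by (auto simp: inj_on_def)
    show "map_prod id h ` vert (subst_diagram A \<sigma>) n = vert (subst_diagram B \<tau>) n" for n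
      using h(2) by force
    show "(\<lambda>(n, l, i). (n, h l, i)) ` edge (subst_diagram A \<sigma>) n = edge (subst_diagram B \<tau>) n" for n
    proof
      show "(\<lambda>(n, l, i). (n, h l, i)) ` edge (subst_diagram A \<sigma>) n \<subseteq> edge (subst_diagram B \<tau>) n"
        using h(2) \<tau> by (auto simp: edge_subst_diagram)
      show "edge (subst_diagram B \<tau>) n \<subseteq> (\<lambda>(n, l, i). (n, h l, i)) ` edge (subst_diagram A \<sigma>) n"
        using h(2) \<tau> by (force simp: edge_subst_diagram)
    qed
  qed (auto simp: \<tau> label le_subst_diagram heq h(2))
qed

text \<open>
  Conjugation by \<open>h\<close>, cut off outside \<open>B\<close> so that the result is a substitution in the extensional
  sense.
\<close>

lemma renamed_substitution_exists:
  assumes fin: "finite A" and ne: "A \<noteq> {}" and \<sigma>: "\<sigma> \<in> A \<rightarrow> lists A" and d: "has_diagram A \<sigma>"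
    and h: "bij_betw h A B"
  obtains \<tau> where "symbolic_substitution B \<tau>" "has_diagram B \<tau>" "renaming_equivalent (A, \<sigma>) (B, \<tau>)"
proof -
  define \<tau> where "\<tau> = restrict (\<lambda>b. map h (\<sigma> (inv_into A h b))) B"
  have hi: "inj_on h A" and B: "B = h ` A" using h by (auto simp: bij_betw_def)
  have \<tau>: "\<tau> (h l) = map h (\<sigma> l)" if "l \<in> A" for l
    using that hi B by (simp add: \<tau>_def)
  have sub: "set (\<sigma> l) \<subseteq> A" if "l \<in> A" for l
    using \<sigma> that by (auto dest: funcset_mem)
  have "\<tau> \<in> B \<rightarrow>\<^sub>E lists B"
  proof (rule PiE_I)
    fix b assume "b \<in> B"
    then obtain l where "l \<in> A" "b = h l" using B by blast
    then show "\<tau> b \<in> lists B" using \<tau> sub[of l] B by (auto simp: in_lists_conv_set)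
  qed (simp add: \<tau>_def)
  then have "symbolic_substitution B \<tau>"
    using fin ne B by (simp add: symbolic_substitution_def)
  moreover have "has_diagram B \<tau>"
    unfolding has_diagram_def B
  proof (intro conjI ballI)
    fix b assume "b \<in> h ` A"
    then obtain l where l: "l \<in> A" "b = h l" by blast
    then show "\<tau> b \<noteq> []" using \<tau> d by (simp add: has_diagram_def)
    from l d obtain k where "k \<in> A" "l \<in> set (\<sigma> k)" by (auto simp: has_diagram_def)
    then show "\<exists>k\<in>h ` A. b \<in> set (\<tau> k)" using \<tau> l by auto
  qed
  moreover have "renaming_equivalent (A, \<sigma>) (B, \<tau>)"
    unfolding renaming_equivalent_def using h \<tau> by auto
  ultimately show ?thesis by (rule that)
qed


section \<open>Powers of a substitution\<close>

primrec subst_power :: "('a \<Rightarrow> 'a list) \<Rightarrow> nat \<Rightarrow> 'a \<Rightarrow> 'a list" where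
  "subst_power \<sigma> 0 l = [l]"
| "subst_power \<sigma> (Suc k) l = concat (map (subst_power \<sigma> k) (\<sigma> l))"

text \<open>
  The defining equation applies \<open>\<sigma>\<close> first, as paths do when they are cut at their last edge; length
  counting needs \<open>\<sigma>\<close> applied last.
\<close>

lemma subst_power_Suc_right: "subst_power \<sigma> (Suc k) l = concat (map \<sigma> (subst_power \<sigma> k l))"
proof (induction k arbitrary: l)
  case 0
  have "concat (map (subst_power \<sigma> 0) xs) = xs" for xs by (induction xs) auto
  then show ?case by simp
next
  case (Suc k)
  have concat_map: "concat (map f (concat xss)) = concat (map (\<lambda>xs. concat (map f xs)) xss)"
    for f :: "'a \<Rightarrow> 'a list" and xss
    by (induction xss) auto
  have "subst_power \<sigma> (Suc (Suc k)) l = concat (map (subst_power \<sigma> (Suc k)) (\<sigma> l))" by simp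
  also have "\<dots> = concat (map (\<lambda>x. concat (map \<sigma> (subst_power \<sigma> k x))) (\<sigma> l))"
    by (simp only: ext[of "subst_power \<sigma> (Suc k)", OF Suc.IH])
  finally show ?case by (simp add: concat_map o_def)
qed

lemma subst_power_closed:
  assumes "\<sigma> \<in> A \<rightarrow> lists A"
  shows "subst_power \<sigma> k \<in> A \<rightarrow> lists A"
proof (induction k)
  case (Suc k)
  show ?case
  proof
    fix l assume "l \<in> A"
    then have "set (\<sigma> l) \<subseteq> A" using assms by (auto dest: funcset_mem)
    then show "subst_power \<sigma> (Suc k) l \<in> lists A"
      using Suc by (fastforce simp: in_lists_conv_set)
  qed
qed simp

lemma letter_in_subst_power:
  assumes "has_diagram A \<sigma>" "l \<in> A"
  shows "\<exists>x\<in>A. l \<in> set (subst_power \<sigma> k x)"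
proof (induction k)
  case (Suc k)
  then obtain x where x: "x \<in> A" "l \<in> set (subst_power \<sigma> k x)" by blast
  with assms obtain y where "y \<in> A" "x \<in> set (\<sigma> y)" by (auto simp: has_diagram_def)
  with x show ?case by auto
qed (use assms in auto)

lemma has_diagram_subst_power:
  assumes "\<sigma> \<in> A \<rightarrow> lists A" "has_diagram A \<sigma>"
  shows "has_diagram A (subst_power \<sigma> k)"
proof -
  have "subst_power \<sigma> k l \<noteq> []" if "l \<in> A" for l
    using that
  proof (induction k arbitrary: l)
    case (Suc k)
    then obtain x xs where "\<sigma> l = x # xs"
      using assms(2) by (auto simp: has_diagram_def neq_Nil_conv)
    moreover from this have "x \<in> A" using assms(1) Suc.prems by (auto dest: funcset_mem)
    ultimately show ?case using Suc.IH by simp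
  qed simp
  then show ?thesis
    using letter_in_subst_power[OF assms(2)] by (auto simp: has_diagram_def)
qed

text \<open>
  Since every letter occurs in the \<open>k\<close>-th power, the next power expands every letter somewhere,
  and at least one of these expansions gains length.
\<close>

lemma total_length_subst_power_less:
  assumes fin: "finite A" and \<sigma>: "\<sigma> \<in> A \<rightarrow> lists A" and d: "has_diagram A \<sigma>"
    and long: "\<exists>l\<in>A. 1 < length (\<sigma> l)"
  shows "(\<Sum>l\<in>A. length (subst_power \<sigma> k l)) < (\<Sum>l\<in>A. length (subst_power \<sigma> (Suc k) l))"
proof (rule sum_strict_mono_ex1[OF fin])
  have len: "length (subst_power \<sigma> (Suc k) l) = (\<Sum>x\<leftarrow>subst_power \<sigma> k l. length (\<sigma> x))" for l
    unfolding subst_power_Suc_right by (simp add: length_concat o_def)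
  have pos: "1 \<le> length (\<sigma> x)" if "l \<in> A" "x \<in> set (subst_power \<sigma> k l)" for l x
    using subst_power_closed[OF \<sigma>, of k] d that
    by (fastforce simp: has_diagram_def Suc_le_eq dest: funcset_mem)
  have gain: "length xs \<le> (\<Sum>x\<leftarrow>xs. length (\<sigma> x))"
    if "\<forall>x\<in>set xs. 1 \<le> length (\<sigma> x)" for xs
    using that by (induction xs) auto
  show "\<forall>l\<in>A. length (subst_power \<sigma> k l) \<le> length (subst_power \<sigma> (Suc k) l)"
    unfolding len using gain pos by blast
  from long obtain x where x: "x \<in> A" "1 < length (\<sigma> x)" by blast
  with letter_in_subst_power[OF d] obtain l where l: "l \<in> A" "x \<in> set (subst_power \<sigma> k l)" by blast
  then obtain ys zs where split: "subst_power \<sigma> k l = ys @ x # zs" by (auto simp: in_set_conv_decomp)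
  then have "length ys \<le> (\<Sum>x\<leftarrow>ys. length (\<sigma> x))" "length zs \<le> (\<Sum>x\<leftarrow>zs. length (\<sigma> x))"
    using pos[OF l(1)] by (auto intro!: gain)
  with x split have "length (subst_power \<sigma> k l) < length (subst_power \<sigma> (Suc k) l)"
    unfolding len by simp
  with l show "\<exists>l\<in>A. length (subst_power \<sigma> k l) < length (subst_power \<sigma> (Suc k) l)" by blast
qed

lemma renaming_equivalent_total_length:
  assumes "renaming_equivalent (A, \<sigma>) (B, \<tau>)"
  shows "(\<Sum>l\<in>A. length (\<sigma> l)) = (\<Sum>l\<in>B. length (\<tau> l))"
proof -
  from assms obtain h where "bij_betw h A B" "\<forall>l\<in>A. \<tau> (h l) = map h (\<sigma> l)"
    unfolding renaming_equivalent_def by auto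
  then show ?thesis by (simp flip: sum.reindex_bij_betw[of h A B])
qed

text \<open>
  The label of a vertex sums the labels found \<open>k\<close> levels below, one summand for each letter of the
  \<open>k\<close>-th power. This is why labels agree after telescoping.
\<close>

lemma subst_label_add:
  "subst_label \<sigma> (j + k) l = (\<Sum>x\<leftarrow>subst_power \<sigma> k l. subst_label \<sigma> j x)"
proof (induction k arbitrary: l)
  case (Suc k)
  have "(\<Sum>x\<leftarrow>concat xss. f x) = (\<Sum>xs\<leftarrow>xss. \<Sum>x\<leftarrow>xs. f x)" for f :: "'a \<Rightarrow> nat" and xss
    by (induction xss) auto
  moreover have "subst_label \<sigma> (j + k) = (\<lambda>l. \<Sum>x\<leftarrow>subst_power \<sigma> k l. subst_label \<sigma> j x)"
    using Suc.IH by (rule ext)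
  ultimately show ?case by (simp add: o_def)
qed simp

lemma subst_label_power: "subst_label (subst_power \<sigma> k) n l = subst_label \<sigma> (k * n) l"
proof (induction n arbitrary: l)
  case (Suc n)
  have "subst_label \<sigma> (k * Suc n) l = subst_label \<sigma> (k * n + k) l" by (simp add: add.commute)
  moreover have "subst_label (subst_power \<sigma> k) n = subst_label \<sigma> (k * n)"
    using Suc.IH by (rule ext)
  ultimately show ?case by (simp only: subst_label_add subst_label.simps)
qed simp


section \<open>Paths in the diagram of a substitution\<close>

lemma paths_snoc:
  "p @ [e] \<in> paths D a (a + Suc k) \<longleftrightarrow>
     p \<in> paths D a (a + k) \<and> e \<in> edge D (Suc (a + k)) \<and> (p = [] \<or> rng D (last p) = src D e)"
proof (cases "length p = k")
  case True
  have "(\<forall>i<length (p @ [e]). (p @ [e]) ! i \<in> edge D (a + i + 1)) \<longleftrightarrow>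
      (\<forall>i<length p. p ! i \<in> edge D (a + i + 1)) \<and> e \<in> edge D (Suc (a + k))"
    using True by (auto simp: less_Suc_eq nth_append)
  moreover have "(\<forall>i. Suc i < length (p @ [e]) \<longrightarrow> rng D ((p @ [e]) ! i) = src D ((p @ [e]) ! Suc i)) \<longleftrightarrow>
      (\<forall>i. Suc i < length p \<longrightarrow> rng D (p ! i) = src D (p ! Suc i)) \<and> (p = [] \<or> rng D (last p) = src D e)"
    (is "?L \<longleftrightarrow> ?R")
  proof (cases "p = []")
    case False
    then have split: "Suc i < length (p @ [e]) \<longleftrightarrow> Suc i < length p \<or> i = length p - 1" for i by auto
    have "rng D ((p @ [e]) ! (length p - 1)) = src D ((p @ [e]) ! Suc (length p - 1))
       \<longleftrightarrow> rng D (last p) = src D e"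
      using False by (simp add: nth_append last_conv_nth)
    moreover have "rng D ((p @ [e]) ! i) = src D ((p @ [e]) ! Suc i) \<longleftrightarrow> rng D (p ! i) = src D (p ! Suc i)"
      if "Suc i < length p" for i using that by (simp add: nth_append)
    ultimately show ?thesis unfolding split using False by blast
  qed simp
  ultimately show ?thesis unfolding paths_def mem_Collect_eq using True by auto
qed (simp add: paths_def)

text \<open>
  The paths of length \<open>k\<close> from level \<open>a\<close> to the vertex of \<open>l\<close> at level \<open>a + k\<close>, in increasing
  order: since the highest edge is compared first, the paths are grouped by their last edge.
\<close>

primrec incoming_paths :: "('a \<Rightarrow> 'a list) \<Rightarrow> nat \<Rightarrow> nat \<Rightarrow> 'a \<Rightarrow> (nat \<times> 'a \<times> nat) list list" where
  "incoming_paths \<sigma> a 0 l = [[]]"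
| "incoming_paths \<sigma> a (Suc k) l =
     concat (map (\<lambda>i. map (\<lambda>p. p @ [(Suc (a + k), l, i)]) (incoming_paths \<sigma> a k (\<sigma> l ! i)))
       [0..<length (\<sigma> l)])"

lemma length_incoming_path: "p \<in> set (incoming_paths \<sigma> a k l) \<Longrightarrow> length p = k"
  by (induction k arbitrary: l p) auto

text \<open>
  Removing the last edge, which arrives at \<open>l\<close> from the \<open>i\<close>-th letter of \<open>\<sigma> l\<close>, leaves a path to
  the vertex of that letter. Empty paths have no range, hence the guard.
\<close>

lemma set_incoming_paths:
  assumes \<sigma>: "\<sigma> \<in> A \<rightarrow> lists A" and "l \<in> A"
  shows "set (incoming_paths \<sigma> a k l) =
    {p \<in> paths (subst_diagram A \<sigma>) a (a + k). p \<noteq> [] \<longrightarrow> rng (subst_diagram A \<sigma>) (last p) = (a + k, l)}"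
    (is "_ = ?S k l")
  using assms(2)
proof (induction k arbitrary: l)
  case 0
  show ?case by (auto simp: paths_def)
next
  case (Suc k)
  have letter: "\<sigma> l ! i \<in> A" if "i < length (\<sigma> l)" for i
    using \<sigma> Suc.prems that by (auto dest!: funcset_mem)
  note IH = Suc.IH[OF letter]
  show ?case
  proof (intro set_eqI iffI)
    fix q assume "q \<in> set (incoming_paths \<sigma> a (Suc k) l)"
    then obtain i p where i: "i < length (\<sigma> l)" and q: "q = p @ [(Suc (a + k), l, i)]"
      and p: "p \<in> set (incoming_paths \<sigma> a k (\<sigma> l ! i))" by auto
    from p IH[OF i] have "p \<in> ?S k (\<sigma> l ! i)" by simp
    then show "q \<in> ?S (Suc k) l"
      unfolding q mem_Collect_eq paths_snoc using i Suc.prems by (auto simp: edge_subst_diagram)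
  next
    fix q assume q: "q \<in> ?S (Suc k) l"
    then have "length q = Suc k" by (simp add: paths_def)
    then obtain p e where qp: "q = p @ [e]" by (metis length_Suc_conv_rev)
    have pe: "p \<in> paths (subst_diagram A \<sigma>) a (a + k)" "e \<in> edge (subst_diagram A \<sigma>) (Suc (a + k))"
      "p = [] \<or> rng (subst_diagram A \<sigma>) (last p) = src (subst_diagram A \<sigma>) e"
      using q unfolding qp mem_Collect_eq paths_snoc by blast+
    then obtain i where i: "i < length (\<sigma> l)" "e = (Suc (a + k), l, i)"
      using q unfolding qp by (auto simp: edge_subst_diagram)
    with pe have "p \<in> ?S k (\<sigma> l ! i)" by auto
    then have "p \<in> set (incoming_paths \<sigma> a k (\<sigma> l ! i))" using IH[OF i(1)] by simp
    then show "q \<in> set (incoming_paths \<sigma> a (Suc k) l)" using i qp by auto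
  qed
qed

text \<open>
  Appending an edge does not change the source of a nonempty path, so the block of paths through
  the \<open>i\<close>-th letter of \<open>\<sigma> l\<close> contributes the word obtained for that letter one level below.
\<close>

lemma sources_incoming_paths:
  "map (\<lambda>p. src (subst_diagram A \<sigma>) (hd p)) (incoming_paths \<sigma> a (Suc k) l) =
     map (Pair a) (subst_power \<sigma> (Suc k) l)"
proof (induction k arbitrary: l)
  case 0
  have "map (\<lambda>i. (a, \<sigma> l ! i)) [0..<length (\<sigma> l)] = map (Pair a) (map ((!) (\<sigma> l)) [0..<length (\<sigma> l)])"
    by (simp add: o_def)
  then show ?case by (simp add: map_concat o_def map_nth)
next
  case (Suc k)
  let ?s = "\<lambda>p. src (subst_diagram A \<sigma>) (hd p)"
  have hd: "map (\<lambda>p. ?s (p @ [e])) (incoming_paths \<sigma> a (Suc k) x) = map ?s (incoming_paths \<sigma> a (Suc k) x)"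
    for e x
    by (rule map_cong[OF refl]) (metis hd_append2 length_incoming_path list.size(3) nat.distinct(1))
  have "map ?s (incoming_paths \<sigma> a (Suc (Suc k)) l) =
     concat (map (\<lambda>i. map ?s (incoming_paths \<sigma> a (Suc k) (\<sigma> l ! i))) [0..<length (\<sigma> l)])"
    by (subst incoming_paths.simps(2)) (simp only: map_concat map_map o_def hd)
  also have "\<dots> = concat (map (\<lambda>x. map (Pair a) (subst_power \<sigma> (Suc k) x))
      (map ((!) (\<sigma> l)) [0..<length (\<sigma> l)]))"
    by (simp only: Suc.IH map_map o_def)
  also have "\<dots> = map (Pair a) (subst_power \<sigma> (Suc (Suc k)) l)"
    by (simp only: map_nth subst_power.simps(2)[of \<sigma> "Suc k"] map_concat map_map o_def)
  finally show ?case .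
qed

lemma path_less_snoc:
  assumes "path_less D p q"
  shows "path_less D (p @ [e]) (q @ [e])"
proof -
  from assms obtain i where i: "i < length p" "(p ! i, q ! i) \<in> le D" "p ! i \<noteq> q ! i"
    "\<forall>j. i < j \<and> j < length p \<longrightarrow> p ! j = q ! j" and len: "length p = length q"
    unfolding path_less_def by blast
  then show ?thesis
    unfolding path_less_def by (auto simp: nth_append intro!: exI[of _ i])
qed

lemma path_less_snoc_edge:
  assumes "length p = length q" "(e, e') \<in> le D" "e \<noteq> e'" "rng D e = rng D e'"
  shows "path_less D (p @ [e]) (q @ [e'])"
  unfolding path_less_def using assms by (auto simp: nth_append intro!: exI[of _ "length q"])

lemma sorted_wrt_concat:
  assumes "\<And>xs. xs \<in> set xss \<Longrightarrow> sorted_wrt R xs"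
    and "sorted_wrt (\<lambda>xs ys. \<forall>x\<in>set xs. \<forall>y\<in>set ys. R x y) xss"
  shows "sorted_wrt R (concat xss)"
  using assms by (induction xss) (auto simp: sorted_wrt_append)

text \<open>
  Within a block all paths share their last edge and inherit the order of their initial parts;
  between blocks the last edges decide.
\<close>

lemma sorted_incoming_paths:
  assumes \<sigma>: "\<sigma> \<in> A \<rightarrow> lists A" and "l \<in> A"
  shows "sorted_wrt (path_less (subst_diagram A \<sigma>)) (incoming_paths \<sigma> a k l)"
  using assms(2)
proof (induction k arbitrary: l)
  case (Suc k)
  let ?R = "path_less (subst_diagram A \<sigma>)"
  let ?P = "\<lambda>i. map (\<lambda>p. p @ [(Suc (a + k), l, i)]) (incoming_paths \<sigma> a k (\<sigma> l ! i))"
  have letter: "\<sigma> l ! i \<in> A" if "i < length (\<sigma> l)" for i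
    using \<sigma> Suc.prems that by (auto dest!: funcset_mem)
  have "sorted_wrt ?R (?P i)" if "i < length (\<sigma> l)" for i
    using Suc.IH[OF letter[OF that]] unfolding sorted_wrt_map
    by (rule sorted_wrt_mono_rel[rotated]) (rule path_less_snoc)
  moreover have "?R x y"
    if "i < j" "j < length (\<sigma> l)" "x \<in> set (?P i)" "y \<in> set (?P j)" for i j x y
    using that Suc.prems
    by (auto intro!: path_less_snoc_edge simp: le_subst_diagram dest!: length_incoming_path)
  then have "sorted_wrt (\<lambda>xs ys. \<forall>x\<in>set xs. \<forall>y\<in>set ys. ?R x y) (map ?P [0..<length (\<sigma> l)])"
    unfolding sorted_wrt_map by (intro sorted_wrt_mono_rel[OF _ sorted_wrt_upt]) auto
  ultimately show ?case
    unfolding incoming_paths.simps by (intro sorted_wrt_concat) auto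
qed simp


section \<open>Telescoping the diagram of a substitution\<close>

text \<open>
  The edge for the \<open>i\<close>-th letter of \<open>\<sigma>\<^sup>K l\<close> is sent to the \<open>i\<close>-th path to \<open>l\<close> in the increasing list
  of paths through \<open>K\<close> levels. This preserves sources because the sources along the list spell
  \<open>\<sigma>\<^sup>K l\<close>, and the order because the list is sorted; the range of a path recovers \<open>n\<close> and \<open>l\<close>.
\<close>

lemma diagram_iso_subst_power:
  assumes \<sigma>: "\<sigma> \<in> A \<rightarrow> lists A" and K: "0 < K"
  shows "diagram_iso (subst_diagram A (subst_power \<sigma> K)) (telescope (\<lambda>n. K * n) (subst_diagram A \<sigma>))"
    (is "diagram_iso ?D' (telescope ?m ?D)")
proof -
  define P where "P n l = incoming_paths \<sigma> (K * (n - 1)) K l" for n l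
  obtain K' where K': "K = Suc K'" using K gr0_conv_Suc by blast
  have level: "K * (n - 1) + K = K * n" if "1 \<le> n" for n
    using that by (cases n) simp_all
  have sources: "map (\<lambda>p. src ?D (hd p)) (P n l) = map (Pair (K * (n - 1))) (subst_power \<sigma> K l)" for n l
    unfolding P_def K' by (rule sources_incoming_paths)
  from arg_cong[OF this, of length] have len: "length (P n l) = length (subst_power \<sigma> K l)" for n l
    by simp
  have src: "src ?D (hd (P n l ! i)) = (K * (n - 1), subst_power \<sigma> K l ! i)"
    if "i < length (subst_power \<sigma> K l)" for n l i
    using arg_cong[OF sources[of n l], of "\<lambda>xs. xs ! i"] that by (simp add: len)
  have setP: "set (P n l) = {p \<in> paths ?D (K * (n - 1)) (K * n). rng ?D (last p) = (K * n, l)}"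
    if "1 \<le> n" "l \<in> A" for n l
  proof -
    have "p \<noteq> []" if "p \<in> paths ?D (K * (n - 1)) (K * n)" for p
      using that K \<open>1 \<le> n\<close> by (cases n) (auto simp: paths_def)
    then show ?thesis
      unfolding P_def set_incoming_paths[OF \<sigma> that(2)] level[OF that(1)] by blast
  qed
  have P: "P n l ! i \<in> paths ?D (K * (n - 1)) (K * n)" "rng ?D (last (P n l ! i)) = (K * n, l)"
    if "1 \<le> n" "l \<in> A" "i < length (subst_power \<sigma> K l)" for n l i
    using setP[OF that(1,2)] nth_mem[of i "P n l"] that(3) len by auto
  have less: "path_less ?D (P n l ! i) (P n l ! j)"
    if "l \<in> A" "i < j" "j < length (subst_power \<sigma> K l)" for n l i j
    using sorted_incoming_paths[OF \<sigma> that(1), of "K * (n - 1)" K] that len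
    unfolding P_def[symmetric] by (auto intro: sorted_wrt_nth_less)
  have less_iff: "P n l ! i = P n l ! j \<or> path_less ?D (P n l ! i) (P n l ! j) \<longleftrightarrow> i \<le> j"
    if "l \<in> A" "i < length (subst_power \<sigma> K l)" "j < length (subst_power \<sigma> K l)" for n l i j
    using less[of l i j n] less[of l j i n] that path_less_irrefl
      path_less_asym[OF antisym_le_subst_diagram[of A \<sigma>], of "P n l ! j" "P n l ! i"]
    by (metis le_less linorder_not_le)
  let ?f = "map_prod ((*) K) id" and ?g = "\<lambda>(n, l, i). P n l ! i"
  have inj: "inj_on ?g {(n, l, i). 1 \<le> n \<and> l \<in> A \<and> i < length (subst_power \<sigma> K l)}"
  proof (rule inj_onI; clarsimp simp del: One_nat_def)
    fix n l i n' l' j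
    assume e: "1 \<le> n" "l \<in> A" "i < length (subst_power \<sigma> K l)"
      and e': "1 \<le> n'" "l' \<in> A" "j < length (subst_power \<sigma> K l')" and eq: "P n l ! i = P n' l' ! j"
    have "(K * n, l) = (K * n', l')"
      by (rule trans[OF P(2)[OF e, symmetric, unfolded eq] P(2)[OF e']])
    then have "n = n'" "l = l'" using K by simp_all
    moreover from this have "i \<le> j" "j \<le> i" using less_iff e e' eq by metis+
    ultimately show "n = n' \<and> l = l' \<and> i = j" by simp
  qed
  show ?thesis
  proof (rule diagram_isoI[of ?f _ _ ?g]; (unfold verts_subst_diagram edges_subst_diagram)?)
    show "inj_on ?f ((UNIV :: nat set) \<times> A)" using K by (auto simp: inj_on_def)
    show "?f ` vert ?D' n = vert (telescope ?m ?D) n" for n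
      by (force simp: telescope_def)
    show "?g ` edge ?D' n = edge (telescope ?m ?D) n" for n
    proof (cases "n = 0")
      case False
      then have n: "1 \<le> n" by simp
      have "edge (telescope ?m ?D) n = (\<Union>l\<in>A. set (P n l))"
      proof -
        have "\<exists>l\<in>A. rng ?D (last p) = (K * n, l)" if "p \<in> paths ?D (K * (n - 1)) (K * n)" for p
          using last_path[OF that] n K by (auto simp: edge_subst_diagram)
        then show ?thesis using n setP[OF n] by (auto simp: telescope_def)
      qed
      also have "\<dots> = ?g ` edge ?D' n"
        using n by (force simp: edge_subst_diagram set_conv_nth len)
      finally show ?thesis by simp
    qed (simp add: telescope_def edge_subst_diagram)
    show "inj_on ?g {(n, l, i). 1 \<le> n \<and> l \<in> A \<and> i < length (subst_power \<sigma> K l)}"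
      by (fact inj)
    show "lab (telescope ?m ?D) (?f v) = lab ?D' v" if "v \<in> (UNIV :: nat set) \<times> A" for v
      by (cases v) (simp add: telescope_def subst_label_power)
    show "src (telescope ?m ?D) (?g e) = ?f (src ?D' e)" "rng (telescope ?m ?D) (?g e) = ?f (rng ?D' e)"
      if "e \<in> {(n, l, i). 1 \<le> n \<and> l \<in> A \<and> i < length (subst_power \<sigma> K l)}" for e
      using that src P(2) by (auto simp: telescope_def)
    show "(?g e, ?g e') \<in> le (telescope ?m ?D) \<longleftrightarrow> (e, e') \<in> le ?D'"
      if "e \<in> {(n, l, i). 1 \<le> n \<and> l \<in> A \<and> i < length (subst_power \<sigma> K l)}"
        "e' \<in> {(n, l, i). 1 \<le> n \<and> l \<in> A \<and> i < length (subst_power \<sigma> K l)}" for e e'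
    proof -
      obtain n l i n' l' j where e: "e = (n, l, i)" "e' = (n', l', j)" by (metis prod_cases3)
      have n: "1 \<le> n" "l \<in> A" "i < length (subst_power \<sigma> K l)"
        and n': "1 \<le> n'" "l' \<in> A" "j < length (subst_power \<sigma> K l')"
        using that e by auto
      show ?thesis
      proof (cases "n = n' \<and> l = l'")
        case True
        have "P n l ! i \<in> edge (telescope ?m ?D) n" "P n l ! j \<in> edge (telescope ?m ?D) n"
          using P(1)[OF n] P(1)[OF n'] True n(1) by (auto simp: telescope_def)
        then have "(P n l ! i, P n l ! j) \<in> le (telescope ?m ?D) \<longleftrightarrow> i \<le> j"
          using less_iff n n' True by (simp only: telescope_le_iff)
        then show ?thesis using e n n' True by (simp add: le_subst_diagram)
      next
        case False
        have "rng ?D (last (P n l ! i)) \<noteq> rng ?D (last (P n' l' ! j))"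
          using P(2)[OF n] P(2)[OF n'] False K by simp
        then have "(?g e, ?g e') \<notin> le (telescope ?m ?D)"
          using e by (auto simp: telescope_def path_less_def)
        then show ?thesis using e False by (auto simp: le_subst_diagram)
      qed
    qed
  qed
qed


section \<open>Infinitely many substitutions\<close>

theorem proposition6p15:
  fixes A :: "'a set" and \<sigma> :: "'a \<Rightarrow> 'a list"
  assumes "symbolic_substitution A \<sigma>" and "has_diagram A \<sigma>"
  shows "\<exists>T :: (nat set \<times> (nat \<Rightarrow> nat list)) set.
           infinite T \<and>
           (\<forall>(B, \<tau>)\<in>T. symbolic_substitution B \<tau> \<and> has_diagram B \<tau> \<and>
              telescope_equivalent (subst_diagram A \<sigma>) (subst_diagram B \<tau>)) \<and>
           ((\<exists>l\<in>A. 1 < length (\<sigma> l)) \<longrightarrow>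
              pairwise (\<lambda>S S'. \<not> renaming_equivalent S S') T)"
proof -
  have fin: "finite A" and ne: "A \<noteq> {}" and \<sigma>: "\<sigma> \<in> A \<rightarrow> lists A"
    using assms(1) by (auto simp: symbolic_substitution_def PiE_def)
  let ?p = "\<lambda>k. subst_power \<sigma> (Suc k)"
  note closed = subst_power_closed[OF \<sigma>] and diag = has_diagram_subst_power[OF \<sigma> assms(2)]
  \<comment> \<open>Shifting the alphabet with the power separates the substitutions even when powers repeat.\<close>
  define B where "B k = {k..<k + card A}" for k
  have "\<exists>\<tau>. symbolic_substitution (B k) \<tau> \<and> has_diagram (B k) \<tau> \<and>
      renaming_equivalent (A, ?p k) (B k, \<tau>)" for k
  proof -
    have "card A = card (B k)" "finite (B k)" by (simp_all add: B_def)
    then obtain h where "bij_betw h A (B k)" using finite_same_card_bij[OF fin] by blast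
    then show ?thesis
      using renamed_substitution_exists[OF fin ne closed diag] by metis
  qed
  then obtain \<tau> where \<tau>: "\<And>k. symbolic_substitution (B k) (\<tau> k)" "\<And>k. has_diagram (B k) (\<tau> k)"
    "\<And>k. renaming_equivalent (A, ?p k) (B k, \<tau> k)"
    by metis
  let ?S = "\<lambda>k. (B k, \<tau> k)"
  have inj_B: "j = k" if "B j = B k" for j k
  proof -
    have "Min (B k) = k" for k
      unfolding B_def using fin ne by (intro Min_eqI) (auto simp: card_gt_0_iff)
    with that show ?thesis by metis
  qed
  then have inf: "infinite (range ?S)"
    by (intro range_inj_infinite injI) blast
  have equiv: "telescope_equivalent (subst_diagram A \<sigma>) (subst_diagram (B k) (\<tau> k))" for k
  proof (rule telescope_equivalentI)
    let ?D = "subst_diagram (B k) (\<tau> k)" and ?Dp = "subst_diagram A (?p k)"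
    show "ordered_bratteli_diagram (subst_diagram A \<sigma>)"
      by (rule ordered_bratteli_subst_diagram[OF fin ne \<sigma> assms(2)])
    show D: "ordered_bratteli_diagram ?D"
      using \<tau>(1,2)[of k] by (intro ordered_bratteli_subst_diagram) (auto simp: symbolic_substitution_def PiE_def)
    show "strict_mono (\<lambda>n. Suc k * n)" by (intro strict_monoI mult_less_mono2) simp_all
    have "ordered_bratteli_diagram ?Dp"
      by (rule ordered_bratteli_subst_diagram[OF fin ne closed diag])
    then have b: "bratteli_diagram ?Dp" "bratteli_diagram ?D"
      using D by (simp_all only: ordered_bratteli_diagram_def)
    have "diagram_iso ?D ?Dp"
      by (rule diagram_iso_sym[OF b(1) diagram_iso_renaming[OF closed \<tau>(3)]])
    from diagram_iso_trans[OF b(2) this diagram_iso_subst_power[OF \<sigma> zero_less_Suc]]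
    show "diagram_iso ?D (telescope (\<lambda>n. Suc k * n) (subst_diagram A \<sigma>))" .
  qed
  have pairwise: "pairwise (\<lambda>S S'. \<not> renaming_equivalent S S') (range ?S)"
    if long: "\<exists>l\<in>A. 1 < length (\<sigma> l)"
  proof -
    let ?N = "\<lambda>k. \<Sum>l\<in>A. length (?p k l)"
    have mono: "strict_mono ?N"
      unfolding strict_mono_Suc_iff
      using total_length_subst_power_less[OF fin \<sigma> assms(2) long] by blast
    have "j = k" if "renaming_equivalent (?S j) (?S k)" for j k
    proof -
      have "?N j = ?N k"
        using renaming_equivalent_total_length[OF that] renaming_equivalent_total_length[OF \<tau>(3)[of j]]
          renaming_equivalent_total_length[OF \<tau>(3)[of k]] by simp
      then show "j = k" by (rule strict_mono_eq[OF mono, THEN iffD1])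
    qed
    then show ?thesis by (auto simp: pairwise_def)
  qed
  show ?thesis
  proof (intro exI[of _ "range ?S"] conjI impI inf pairwise)
    show "\<forall>(B, \<tau>)\<in>range ?S. symbolic_substitution B \<tau> \<and> has_diagram B \<tau> \<and>
        telescope_equivalent (subst_diagram A \<sigma>) (subst_diagram B \<tau>)"
      using \<tau>(1,2) equiv by (simp only: ball_simps case_prod_conv simp_thms)
  qed
qed

end
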